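(* In the decimal model $\mathbb{R}$ of real numbers described in the context, the equation $x^2=[2]$ has no solution in the set of ultimately periodic real numbers $[\mathbb{P}]$.
   Context: Here $\mathbb{N}=\{1,2,\dots\}$, and the ordered ring $\mathbb{Z}$ of integers is taken as given; $\mathbb{R}$ denotes the set constructed below. Decimals. A signed decimal $d$ is a pair of a sign $+$ or $-$ and an infinite string of digits $d=\pm a_ka_{k-1}a_{k-2}\dots$ indexed by the integers $k,k-1,k-2,\dots$, where $k\in\mathbb{Z}$, $a_i\in\{0,1,\dots,9\}\subset\mathbb{Z}$ and $a_k\neq 0$. The zero decimal $0$ has no sign and only zero digits. $\mathbb{D}$ is the set of all decimals (signed and zero). $d_i$ denotes the $i$th digit $a_i$ of $d$, with $d_i=0$ if $a_i$ does not exist. Two decimals are equal iff they have equal signs and $d_i=e_i$ for all $i\in\mathbb{Z}$, or both are zero. $-d$ is $d$ with the opposite sign, and $-0=0$. The usual decimal point notation is used ($+$ sign and trailing zeros omitted); in particular $2=2.000\dots\in\mathbb{D}$. Order on $\mathbb{D}$. For $d\ne e$ put $d<e$ iff one of the following holds: $d$ and $e$ both have sign $+$ (respectively both have sign $-$) and there is $m\in\mathbb{Z}$ with $d_i=e_i$ for $i>m$ and $d_m<e_m$ (respectively $d_m>e_m$); or $d$ has sign $-$ and $e$ is $0$ or has sign $+$; or $d=0$ and $e$ has sign $+$. This is a linear order. Real numbers. A jump is a pair $d<e$ in $\mathbb{D}$ with no decimal $f$ such that $d<f<e$ (for example $0.999\dots<1$). Write $d\sim e$ iff $d=e$, or $d<e$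 is a jump, or $e<d$ is a jump; this is an equivalence relation. Set $\mathbb{R}=\mathbb{D}/\!\sim$, and let $[d]$ be the equivalence class of $d$. For $X\subset\mathbb{D}$, $[X]$ denotes the set of elements of $\mathbb{R}$ (equivalence classes) that intersect $X$. Ultimately periodic decimals. $\mathbb{P}$ is the set of $d\in\mathbb{D}$ for which there are $m\in\mathbb{Z}$ and $p\in\mathbb{N}$ such that $d_i=d_{i-p}$ for every $i<m$. Terminating decimals. $\mathbb{T}_0$ is the set of decimals with only finitely many nonzero digits (including $0$), and $\mathbb{Z}_0$ is the set of decimals $d$ with $d_i=0$ for all $i<0$. Decadic notation $0\mapsto 0$, $\pm a_k\dots a_0000\dots\mapsto\pm(a_k10^k+\dots+a_010^0)$ is a bijection $\mathbb{Z}_0\to\mathbb{Z}$, and $+,\cdot$ on $\mathbb{Z}_0$ are transferred from $\mathbb{Z}$ by it. For $d\in\mathbb{D}$ and $k\in\mathbb{Z}$, $10^kd$ is the decimal with the same sign as $d$ and $(10^kd)_i=d_{i-k}$. For $c,d\in\mathbb{T}_0$ define $c+d=10^{-k}(10^kc+10^kd)$ and $c\cdot d=10^{-2k}(10^kc\cdot 10^kd)$, where $k$ is any integer with $10^kc,10^kd\in\mathbb{Z}_0$ (the results do not depend on $k$); $c-d=c+(-d)$. Hybrid limits. For $n\in\mathbb{N}$ and $d\in\mathbb{D}$ the truncation $d|n\in\mathbb{T}_0$ has the same sign as $d$ and $(d|n)_i=d_i$ for $i\ge -n$, $(d|n)_i=0$ for $i<-n$; if all its digits are zero, $d|n$ is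 the zero decimal. For terminating decimals $c(n)$, $n=1,2,\dots$, write $c(n)\to 0$ if for every $k\in\mathbb{N}$ there is $N\in\mathbb{N}$ with $c(n)|k=0$ for all $n>N$. A decimal $c$ is a hybrid limit of the sequence $c(n)$ if $c(n)-c|n\to 0$. $\mathrm{hlim}_n\,c(n)$ denotes the set of all hybrid limits of $c(n)$; if nonempty it is a single equivalence class, i.e. an element of $\mathbb{R}$. Arithmetic on $\mathbb{R}$. For $\alpha,\beta\in\mathbb{R}$, $\alpha+\beta=\mathrm{hlim}_n\,(c|n+d|n)$ and $\alpha\beta=\mathrm{hlim}_n\,(c|n\cdot d|n)$, where $c\in\alpha$ and $d\in\beta$ are arbitrary decimals (the limits exist and do not depend on the choice of $c,d$); $x^2=x\cdot x$. *)

theory Defs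
  imports Main
begin

datatype sign = Plus | Minus

text \<open>The string \<open>a\<^sub>k a\<^sub>k\<^sub>-\<^sub>1 a\<^sub>k\<^sub>-\<^sub>2 \<dots>\<close> with \<open>a\<^sub>k \<noteq> 0\<close> is stored as its extension
  by zeros to all integer positions, from which \<open>k\<close> can be read off.\<close>

typedef digit_string =
  "{a :: int \<Rightarrow> int. (\<forall>i. a i \<in> {0..9}) \<and> (\<exists>k. a k \<noteq> 0 \<and> (\<forall>i>k. a i = 0))}"
  by (rule exI[of _ "\<lambda>i. if i = 0 then 1 else 0"]) (auto intro: exI[of _ 0])

datatype decimal = Zero | Signed sign digit_string

primrec digit :: "decimal \<Rightarrow> int \<Rightarrow> int" where
  "digit Zero i = 0"
| "digit (Signed s a) i = Rep_digit_string a i"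

text \<open>Only meant for \<open>a\<close> that is identically zero or an extended digit string as above.\<close>

definition make_decimal :: "sign \<Rightarrow> (int \<Rightarrow> int) \<Rightarrow> decimal" where
  "make_decimal s a =
     (if \<forall>i. a i = 0 then Zero else Signed s (Abs_digit_string a))"

primrec neg_sign :: "sign \<Rightarrow> sign" where
  "neg_sign Plus = Minus"
| "neg_sign Minus = Plus"

primrec neg :: "decimal \<Rightarrow> decimal" where
  "neg Zero = Zero"
| "neg (Signed s a) = Signed (neg_sign s) a"

definition two :: decimal where
  "two = make_decimal Plus (\<lambda>i. if i = 0 then 2 else 0)"

definition lex_less :: "digit_string \<Rightarrow> digit_string \<Rightarrow> bool" where
  "lex_less a b \<longleftrightarrow>
     (\<exists>m. (\<forall>i>m. Rep_digit_string a i = Rep_digit_string b i) \<and>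
          Rep_digit_string a m < Rep_digit_string b m)"

fun less_decimal :: "decimal \<Rightarrow> decimal \<Rightarrow> bool" where
  "less_decimal (Signed Plus a) (Signed Plus b) \<longleftrightarrow> lex_less a b"
| "less_decimal (Signed Minus a) (Signed Minus b) \<longleftrightarrow> lex_less b a"
| "less_decimal (Signed Minus a) Zero \<longleftrightarrow> True"
| "less_decimal (Signed Minus a) (Signed Plus b) \<longleftrightarrow> True"
| "less_decimal Zero (Signed Plus b) \<longleftrightarrow> True"
| "less_decimal _ _ \<longleftrightarrow> False"

definition jump :: "decimal \<Rightarrow> decimal \<Rightarrow> bool" where
  "jump d e \<longleftrightarrow>
     less_decimal d e \<and> \<not> (\<exists>f. less_decimal d f \<and> less_decimal f e)"

definition sim :: "(decimal \<times> decimal) set" where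
  "sim = {(d, e). d = e \<or> jump d e \<or> jump e d}"

definition dec_reals :: "decimal set set" where
  "dec_reals = UNIV // sim"

definition class_of :: "decimal \<Rightarrow> decimal set" where
  "class_of d = sim `` {d}"

definition classes_meeting :: "decimal set \<Rightarrow> decimal set set" where
  "classes_meeting X = {\<alpha> \<in> dec_reals. \<alpha> \<inter> X \<noteq> {}}"

definition ultimately_periodic :: "decimal set" where
  "ultimately_periodic =
     {d. \<exists>m. \<exists>p::nat. p \<ge> 1 \<and> (\<forall>i<m. digit d i = digit d (i - int p))}"

definition integer_decimals :: "decimal set" where
  "integer_decimals = {d. \<forall>i<0. digit d i = 0}"

definition abs_value :: "decimal \<Rightarrow> int" where
  "abs_value d = (\<Sum>i \<in> {i. i \<ge> 0 \<and> digit d i \<noteq> 0}. digit d i * 10 ^ nat i)"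

fun decadic :: "decimal \<Rightarrow> int" where
  "decadic Zero = 0"
| "decadic (Signed Plus a) = abs_value (Signed Plus a)"
| "decadic (Signed Minus a) = - abs_value (Signed Minus a)"

definition decimal_of_int :: "int \<Rightarrow> decimal" where
  "decimal_of_int = the_inv_into integer_decimals decadic"

text \<open>\<open>shift k d\<close> is \<open>10\<^sup>k d\<close>.\<close>

primrec shift :: "int \<Rightarrow> decimal \<Rightarrow> decimal" where
  "shift k Zero = Zero"
| "shift k (Signed s a) = make_decimal s (\<lambda>i. Rep_digit_string a (i - k))"

text \<open>An arbitrary exponent \<open>k\<close> that makes both arguments integral; it exists
  exactly when both have finitely many nonzero digits, the only case in which the
  operations below are used.\<close>

definition common_shift :: "decimal \<Rightarrow> decimal \<Rightarrow> int" where
  "common_shift c d =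
     (SOME k. shift k c \<in> integer_decimals \<and> shift k d \<in> integer_decimals)"

definition t_add :: "decimal \<Rightarrow> decimal \<Rightarrow> decimal" where
  "t_add c d = (let k = common_shift c d in
     shift (- k) (decimal_of_int (decadic (shift k c) + decadic (shift k d))))"

definition t_mult :: "decimal \<Rightarrow> decimal \<Rightarrow> decimal" where
  "t_mult c d = (let k = common_shift c d in
     shift (- 2 * k) (decimal_of_int (decadic (shift k c) * decadic (shift k d))))"

definition t_diff :: "decimal \<Rightarrow> decimal \<Rightarrow> decimal" where
  "t_diff c d = t_add c (neg d)"

primrec truncate :: "decimal \<Rightarrow> nat \<Rightarrow> decimal" where
  "truncate Zero n = Zero"
| "truncate (Signed s a) n =
     make_decimal s (\<lambda>i. if i \<ge> - int n then Rep_digit_string a i else 0)"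

text \<open>Sequences are indexed by \<open>n \<ge> 1\<close>; the value at \<open>0\<close> is never inspected, since \<open>N \<ge> 1\<close>.\<close>

definition tends_to_zero :: "(nat \<Rightarrow> decimal) \<Rightarrow> bool" where
  "tends_to_zero c \<longleftrightarrow> (\<forall>k\<ge>1. \<exists>N\<ge>1. \<forall>n>N. truncate (c n) k = Zero)"

definition hlim :: "(nat \<Rightarrow> decimal) \<Rightarrow> decimal set" where
  "hlim c = {d. tends_to_zero (\<lambda>n. t_diff (c n) (truncate d n))}"

text \<open>The factors are represented by arbitrarily chosen members; for real numbers \<open>\<alpha>\<close>, \<open>\<beta>\<close>
  the hybrid limit does not depend on the choice.\<close>

definition r_mult :: "decimal set \<Rightarrow> decimal set \<Rightarrow> decimal set" where
  "r_mult \<alpha> \<beta> = (let c = (SOME c. c \<in> \<alpha>); d = (SOME d. d \<in> \<beta>) in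
     hlim (\<lambda>n. t_mult (truncate c n) (truncate d n)))"

definition r_square :: "decimal set \<Rightarrow> decimal set" where
  "r_square x = r_mult x x"

end

theory Submission
  imports Complex_Main Defs
begin

text \<open>Let \<open>c\<close> be a decimal with \<open>c \<cdot> c = 2\<close>, and let \<open>s\<^sub>n \<ge> 0\<close> be the absolute value of the
  truncation \<open>c|n\<close>. That \<open>2\<close> is a hybrid limit of the squares means \<open>s\<^sub>n\<^sup>2 \<longlonglongrightarrow> 2\<close>, so
  \<open>s\<^sub>n \<longlonglongrightarrow> sqrt 2\<close> in the library's reals. If \<open>c\<close> is ultimately periodic with period \<open>p\<close>, then
  \<open>10\<^sup>p s\<^bsub>n+p\<^esub> - s\<^sub>n\<close> is eventually constant and rational, and it tends to
  \<open>(10\<^sup>p - 1) sqrt 2\<close>, a contradiction. The arbitrary representative \<open>c\<close> of a class that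
  meets the periodic decimals is itself periodic, because the two ends of a jump terminate in nines
  and in zeros, respectively.\<close>

section \<open>Digits\<close>

lemma digit_range: "digit d i \<in> {0..9}"
  using Rep_digit_string by (cases d) auto

lemma digit_nonneg: "0 \<le> digit d i" and digit_le_9: "digit d i \<le> 9"
  using digit_range[of d i] by auto

lemma digit_eventually_zero: "\<exists>k. \<forall>i>k. digit d i = 0"
proof (cases d)
  case (Signed s a)
  then show ?thesis using Rep_digit_string[of a] by auto
qed simp

lemma digit_Signed_nonzero: "\<exists>i. digit (Signed s a) i \<noteq> 0"
  using Rep_digit_string[of a] by auto

text \<open>The nonzero positions lie between \<open>j\<close> and \<open>k\<close>, so there are
  finitely many and at least one; the largest of them is the leading position that the type
  demands.\<close>

lemma ex_digit_string:
  assumes range: "\<And>i. f i \<in> {0..9}" and bound: "\<And>i. i > k \<Longrightarrow> f i = 0" and j: "f j \<noteq> 0"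
  shows "\<exists>a. Rep_digit_string a = f"
proof -
  let ?S = "{i \<in> {j..k}. f i \<noteq> 0}"
  have "j \<le> k" using bound j by force
  with j have S: "finite ?S" "?S \<noteq> {}" by (auto intro: finite_subset[of _ "{j..k}"])
  have "f i = 0" if "i > Max ?S" for i
  proof (rule ccontr)
    assume nz: "f i \<noteq> 0"
    have "j \<le> Max ?S" using Max_in[OF S] by simp
    moreover have "i \<le> k" using nz bound by force
    ultimately have "i \<in> ?S" using nz that by auto
    then show False using Max_ge[OF S(1)] that by force
  qed
  moreover have "f (Max ?S) \<noteq> 0" using Max_in[OF S] by simp
  ultimately have "f \<in> {a. (\<forall>i. a i \<in> {0..9}) \<and> (\<exists>k. a k \<noteq> 0 \<and> (\<forall>i>k. a i = 0))}"
    using range by blast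
  then show ?thesis using Abs_digit_string_inverse by blast
qed

text \<open>\<open>Abs_digit_string\<close> is specified only on the representing set. The two
  hypotheses put every \<open>f\<close> that is not identically zero into that set.\<close>

lemma make_decimal_cases:
  assumes "\<And>i. f i \<in> {0..9}" and "\<And>i. i > k \<Longrightarrow> f i = 0"
  obtains "make_decimal s f = Zero" "f = (\<lambda>i. 0)"
    | a where "make_decimal s f = Signed s a" "Rep_digit_string a = f"
proof (cases "\<forall>i. f i = 0")
  case True
  then show ?thesis using that(1) by (auto simp: make_decimal_def)
next
  case False
  then obtain a where "Rep_digit_string a = f" using ex_digit_string assms by metis
  then show ?thesis
    using that(2) False by (auto simp: make_decimal_def Rep_digit_string_inverse)
qed

lemma digit_make_decimal:
  assumes "\<And>i. f i \<in> {0..9}" and "\<And>i. i > k \<Longrightarrow> f i = 0"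
  shows "digit (make_decimal s f) = f"
  by (rule make_decimal_cases[OF assms, where s = s]) (auto simp: fun_eq_iff)

lemma digit_shift: "digit (shift k d) i = digit d (i - k)"
proof (cases d)
  case (Signed s a)
  obtain l where "\<forall>i>l. digit d i = 0" using digit_eventually_zero by blast
  then show ?thesis
    using digit_range[of d] Signed
    by (auto simp: digit_make_decimal[where k = "l + k"])
qed simp

lemma digit_truncate: "digit (truncate d n) i = (if i \<ge> - int n then digit d i else 0)"
proof (cases d)
  case (Signed s a)
  obtain l where "\<forall>i>l. digit d i = 0" using digit_eventually_zero by blast
  then show ?thesis
    using digit_range[of d] Signed
    by (auto simp: digit_make_decimal[where k = "l"])
qed simp

lemma digit_neg: "digit (neg d) i = digit d i"
  by (cases d) auto

lemma digit_two: "digit two i = (if i = 0 then 2 else 0)"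
  unfolding two_def by (subst digit_make_decimal[where k = 0]) auto

section \<open>Signs and equality of decimals\<close>

primrec sign_value :: "sign \<Rightarrow> int" where
  "sign_value Plus = 1"
| "sign_value Minus = -1"

text \<open>\<open>digit\<close> forgets the sign. This integer restores it, and it serves as the
  factor that turns absolute values into signed ones.\<close>

primrec dec_sgn :: "decimal \<Rightarrow> int" where
  "dec_sgn Zero = 0"
| "dec_sgn (Signed s a) = sign_value s"

lemma decimal_eqI:
  assumes "dec_sgn d = dec_sgn e" and "\<And>i. digit d i = digit e i"
  shows "d = e"
proof (cases d; cases e)
  fix s t a b assume d: "d = Signed s a" and e: "e = Signed t b"
  from assms(2) have "a = b"
    by (simp add: d e flip: Rep_digit_string_inject) (simp add: fun_eq_iff)
  moreover from assms(1) have "s = t" by (cases s; cases t) (auto simp: d e)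
  ultimately show ?thesis by (simp add: d e)
next
  fix s a assume "d = Signed s a" "e = Zero"
  then show ?thesis using assms(1) by (cases s) auto
next
  fix s a assume "d = Zero" "e = Signed s a"
  then show ?thesis using assms(1) by (cases s) auto
qed simp

lemma dec_sgn_make_decimal:
  "dec_sgn (make_decimal s f) = (if \<forall>i. f i = 0 then 0 else sign_value s)"
  by (simp add: make_decimal_def)

lemma dec_sgn_shift: "dec_sgn (shift k d) = dec_sgn d"
proof (cases d)
  case (Signed s a)
  obtain i where "digit d i \<noteq> 0" using digit_Signed_nonzero Signed by blast
  then have "Rep_digit_string a ((i + k) - k) \<noteq> 0" using Signed by simp
  then have "\<exists>i. Rep_digit_string a (i - k) \<noteq> 0" by blast
  then show ?thesis using Signed by (auto simp: dec_sgn_make_decimal)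
qed simp

lemma dec_sgn_neg: "dec_sgn (neg d) = - dec_sgn d"
proof (cases d)
  case (Signed s a)
  then show ?thesis by (cases s) auto
qed simp

lemma dec_sgn_two: "dec_sgn two = 1"
  unfolding two_def by (auto simp: dec_sgn_make_decimal)

lemma truncate_two: "truncate two n = two"
proof (rule decimal_eqI)
  show "dec_sgn (truncate two n) = dec_sgn two"
  proof (cases two)
    case (Signed s a)
    then have "digit (Signed s a) 0 = 2" using digit_two[of 0] by metis
    then have "\<exists>i\<ge>- int n. Rep_digit_string a i \<noteq> 0" by (intro exI[of _ 0]) simp
    then show ?thesis
      unfolding Signed by (auto simp: dec_sgn_make_decimal)
  qed simp
qed (simp add: digit_truncate digit_two)

section \<open>Jumps\<close>

text \<open>Let \<open>m\<close> be the position where the strings first differ. Below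
  \<open>m\<close>, a nonzero digit of \<open>b\<close> could be lowered, or a digit of
  \<open>a\<close> other than 9 raised, and either change would give a string strictly in
  between.\<close>

lemma lex_jump_tails:
  assumes "lex_less a b" and nb: "\<not> (\<exists>c. lex_less a c \<and> lex_less c b)"
  shows "\<exists>m. \<forall>i<m. Rep_digit_string a i = 9 \<and> Rep_digit_string b i = 0"
proof -
  let ?a = "Rep_digit_string a" and ?b = "Rep_digit_string b"
  obtain m where eq: "\<And>i. i > m \<Longrightarrow> ?a i = ?b i" and less: "?a m < ?b m"
    using assms(1) by (auto simp: lex_less_def)
  have ran: "?a i \<in> {0..9}" "?b i \<in> {0..9}" for i
    using digit_range[of "Signed Plus _" i] by (metis digit.simps(2))+
  obtain k l where k: "\<forall>i>k. ?a i = 0" and l: "\<forall>i>l. ?b i = 0"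
    using digit_eventually_zero[of "Signed Plus a"] digit_eventually_zero[of "Signed Plus b"] by auto
  have "?b j = 0" if j: "j < m" for j
  proof (rule ccontr)
    assume nz: "?b j \<noteq> 0"
    \<comment> \<open>The digit at \<open>m\<close> is untouched. It exceeds a digit of
      \<open>a\<close>, so it is nonzero and also keeps the new string above
      \<open>a\<close>.\<close>
    have "\<exists>c. Rep_digit_string c = ?b(j := ?b j - 1)"
    proof (rule ex_digit_string[where k = l and j = m])
      show "(?b(j := ?b j - 1)) i \<in> {0..9}" for i
        using ran(2)[of i] nz by auto
      show "(?b(j := ?b j - 1)) m \<noteq> 0"
        using less j ran(1)[of m] by auto
    qed (use l nz in auto)
    then obtain c where c: "Rep_digit_string c = ?b(j := ?b j - 1)" by blast
    have "lex_less a c" unfolding lex_less_def c using eq less j by (intro exI[of _ m]) auto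
    moreover have "lex_less c b" unfolding lex_less_def c by (intro exI[of _ j]) auto
    ultimately show False using nb by blast
  qed
  moreover have "?a j = 9" if j: "j < m" for j
  proof (rule ccontr)
    assume n9: "?a j \<noteq> 9"
    \<comment> \<open>Position \<open>j\<close> may lie above the leading digit of \<open>a\<close>,
      hence the bound \<open>max k j\<close>.\<close>
    have "\<exists>c. Rep_digit_string c = ?a(j := ?a j + 1)"
    proof (rule ex_digit_string[where k = "max k j" and j = j])
      show "(?a(j := ?a j + 1)) i \<in> {0..9}" for i
        using ran(1)[of i] n9 by auto
      show "(?a(j := ?a j + 1)) j \<noteq> 0"
        using ran(1)[of j] by auto
    qed (use k in auto)
    then obtain c where c: "Rep_digit_string c = ?a(j := ?a j + 1)" by blast
    have "lex_less c b" unfolding lex_less_def c using eq less j by (intro exI[of _ m]) auto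
    moreover have "lex_less a c" unfolding lex_less_def c by (intro exI[of _ j]) auto
    ultimately show False using nb by blast
  qed
  ultimately show ?thesis by blast
qed

text \<open>Division by ten yields a smaller string. Consequently \<open>Zero\<close> is not an end
  of any jump.\<close>

lemma ex_lex_less: "\<exists>c. lex_less c b"
proof -
  let ?b = "Rep_digit_string b"
  obtain k where k: "?b k \<noteq> 0" "\<forall>i>k. ?b i = 0" using Rep_digit_string[of b] by auto
  have ran: "?b i \<in> {0..9}" for i using Rep_digit_string[of b] by auto
  have "\<exists>c. Rep_digit_string c = (\<lambda>i. ?b (i + 1))"
    by (rule ex_digit_string[where k = k and j = "k - 1"]) (use k ran in auto)
  then obtain c where c: "Rep_digit_string c = (\<lambda>i. ?b (i + 1))" by blast
  have "?b k > 0" using k(1) ran[of k] by auto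
  then have "lex_less c b" unfolding lex_less_def c using k by (intro exI[of _ k]) auto
  then show ?thesis by blast
qed

text \<open>\<open>Zero\<close> separates opposite signs and is itself not an end of a jump, so both
  ends have the same sign. Their tails are then constant, hence of period 1; for negative decimals
  the nines and zeros swap sides.\<close>

lemma jump_ultimately_periodic:
  assumes "jump d e"
  shows "d \<in> ultimately_periodic \<and> e \<in> ultimately_periodic"
proof -
  have tails: ?thesis if "\<forall>i<m. digit d i = x \<and> digit e i = y" for m x y
  proof -
    have "\<forall>i<m. digit d i = digit d (i - int 1) \<and> digit e i = digit e (i - int 1)"
      using that by simp
    then show ?thesis unfolding ultimately_periodic_def by blast
  qed
  have less: "less_decimal d e" and nb: "\<And>f. less_decimal d f \<Longrightarrow> \<not> less_decimal f e"
    using assms by (auto simp: jump_def)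
  from less show ?thesis
  proof (cases "(d, e)" rule: less_decimal.cases)
    case (1 a b)
    have "\<not> (\<exists>c. lex_less a c \<and> lex_less c b)"
      using nb[of "Signed Plus _"] 1 by auto
    then show ?thesis using lex_jump_tails[of a b] less tails 1 by fastforce
  next
    case (2 a b)
    have "\<not> (\<exists>c. lex_less b c \<and> lex_less c a)"
      using nb[of "Signed Minus _"] 2 by auto
    then show ?thesis using lex_jump_tails[of b a] less tails 2 by fastforce
  next
    case (3 a)
    then show ?thesis using ex_lex_less[of a] nb[of "Signed Minus _"] by auto
  next
    case (4 a b)
    then show ?thesis using nb[of Zero] by auto
  next
    case (5 b)
    then show ?thesis using ex_lex_less[of b] nb[of "Signed Plus _"] by auto
  qed auto
qed

lemma sim_ultimately_periodic:
  assumes "(d, e) \<in> sim" and "d \<in> ultimately_periodic \<or> e \<in> ultimately_periodic"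
  shows "d \<in> ultimately_periodic \<and> e \<in> ultimately_periodic"
  using assms jump_ultimately_periodic by (auto simp: sim_def)

section \<open>Decadic notation\<close>

text \<open>Splitting off the lowest digit writes the sum as \<open>f 0 + 10 * r\<close>, so
  division by 10 shifts the digit sequence by one place.\<close>

lemma digit_sum_div_mod:
  fixes f :: "nat \<Rightarrow> int"
  assumes "\<And>i. f i \<in> {0..9}" and "j < n"
  shows "(\<Sum>i<n. f i * 10 ^ i) div 10 ^ j mod 10 = f j"
  using assms
proof (induction n arbitrary: f j)
  case (Suc n)
  let ?r = "\<Sum>i<n. f (Suc i) * 10 ^ i"
  have eq: "(\<Sum>i<Suc n. f i * 10 ^ i) = f 0 + 10 * ?r"
    by (subst sum.lessThan_Suc_shift) (simp add: sum_distrib_left mult_ac)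
  have f0: "0 \<le> f 0" "f 0 < 10" using Suc.prems(1)[of 0] by auto
  show ?case
  proof (cases j)
    case 0
    then show ?thesis using f0 by (simp add: eq del: sum.lessThan_Suc)
  next
    case (Suc j')
    have "(f 0 + 10 * ?r) div 10 ^ j = ?r div 10 ^ j'"
      using f0 by (simp add: Suc zdiv_zmult2_eq)
    then show ?thesis
      using Suc.IH[of "\<lambda>i. f (Suc i)" j'] Suc Suc.prems by (simp add: eq del: sum.lessThan_Suc)
  qed
qed simp

lemma sum_div_mod_digits:
  fixes z :: int
  shows "(\<Sum>i<n. (z div 10 ^ i mod 10) * 10 ^ i) = z mod 10 ^ n"
proof (induction n)
  case (Suc n)
  have "z mod (10 ^ n * 10) = 10 ^ n * (z div 10 ^ n mod 10) + z mod 10 ^ n"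
    by (rule zmod_zmult2_eq) simp
  then show ?case using Suc by (simp add: mult_ac)
qed simp

lemma ex_power10_gt: "\<exists>n. (z::int) < 10 ^ n"
proof -
  have "z \<le> int (nat z)" by simp
  also have "\<dots> < 2 ^ nat z" by (metis of_nat_less_two_power)
  also have "\<dots> \<le> 10 ^ nat z" by (rule power_mono) auto
  finally show ?thesis by blast
qed

lemma abs_value_eq_sum:
  assumes "\<And>i. i \<ge> int n \<Longrightarrow> digit d i = 0"
  shows "abs_value d = (\<Sum>i<n. digit d (int i) * 10 ^ i)"
proof -
  have "abs_value d = (\<Sum>i\<in>int ` {..<n}. digit d i * 10 ^ nat i)"
    unfolding abs_value_def
  proof (rule sum.mono_neutral_left)
    show "{i. 0 \<le> i \<and> digit d i \<noteq> 0} \<subseteq> int ` {..<n}"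
    proof
      fix i assume i: "i \<in> {i. 0 \<le> i \<and> digit d i \<noteq> 0}"
      then have "i < int n" using assms[of i] by (cases "i < int n") auto
      then show "i \<in> int ` {..<n}" using i by (intro image_eqI[of _ _ "nat i"]) auto
    qed
  qed auto
  also have "\<dots> = (\<Sum>i<n. digit d (int i) * 10 ^ i)"
    by (subst sum.reindex) auto
  finally show ?thesis .
qed

lemma ex_nat_digit_bound: "\<exists>n. \<forall>i\<ge>int n. digit d i = 0"
proof -
  obtain k where "\<forall>i>k. digit d i = 0" using digit_eventually_zero by blast
  then have "\<forall>i\<ge>int (nat (k + 1)). digit d i = 0" by auto
  then show ?thesis by blast
qed

lemma abs_value_nonneg: "abs_value d \<ge> 0"
  unfolding abs_value_def by (intro sum_nonneg) (auto simp: digit_nonneg)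

lemma decadic_eq: "decadic d = dec_sgn d * abs_value d"
  by (cases d rule: decadic.cases) auto

lemma digit_eq_abs_value_div_mod: "digit d (int j) = abs_value d div 10 ^ j mod 10"
proof -
  obtain n where n: "\<forall>i\<ge>int n. digit d i = 0" using ex_nat_digit_bound by blast
  \<comment> \<open>The range must cover the support and also \<open>j\<close>, which may lie beyond
    the leading digit.\<close>
  have "abs_value d = (\<Sum>i<max n (Suc j). digit d (int i) * 10 ^ i)"
    by (rule abs_value_eq_sum) (use n in auto)
  then show ?thesis
    using digit_sum_div_mod[of "\<lambda>i. digit d (int i)" j "max n (Suc j)"] digit_range by simp
qed

lemma abs_value_pos:
  assumes "Signed s a \<in> integer_decimals"
  shows "abs_value (Signed s a) > 0"
proof (rule ccontr)
  assume "\<not> ?thesis"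
  then have "abs_value (Signed s a) = 0" using abs_value_nonneg[of "Signed s a"] by simp
  then have "digit (Signed s a) (int j) = 0" for j
    using digit_eq_abs_value_div_mod[of "Signed s a" j] by simp
  moreover have "digit (Signed s a) i = 0" if "i < 0" for i
    using assms that unfolding integer_decimals_def by blast
  ultimately have "digit (Signed s a) i = 0" for i
    by (metis int_nat_eq not_less nat_0_le)
  then show False using digit_Signed_nonzero by blast
qed

text \<open>An explicit inverse of \<open>decadic\<close>, to replace the
  \<open>the_inv_into\<close> of \<open>decimal_of_int\<close>. For \<open>z = 0\<close> all digits
  vanish and \<open>make_decimal\<close> returns \<open>Zero\<close> whatever the sign.\<close>

definition int_decimal :: "int \<Rightarrow> decimal" where
  "int_decimal z = make_decimal (if z \<ge> 0 then Plus else Minus)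
     (\<lambda>i. if i < 0 then 0 else \<bar>z\<bar> div 10 ^ nat i mod 10)"

lemma int_decimal_digit:
  "digit (int_decimal z) i = (if i < 0 then 0 else \<bar>z\<bar> div 10 ^ nat i mod 10)"
proof -
  obtain n where n: "\<bar>z\<bar> < 10 ^ n" using ex_power10_gt by blast
  have "\<bar>z\<bar> div 10 ^ nat i = 0" if "i > int n" for i
  proof -
    have "(10::int) ^ n \<le> 10 ^ nat i" by (rule power_increasing) (use that in auto)
    then show ?thesis using n by (intro div_pos_pos_trivial) linarith+
  qed
  moreover have "0 \<le> x mod 10 \<and> x mod 10 \<le> 9" for x :: int
    using pos_mod_sign[of 10 x] pos_mod_bound[of 10 x] by linarith
  ultimately show ?thesis
    unfolding int_decimal_def
    by (subst digit_make_decimal[where k = "int n"]) auto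
qed

lemma int_decimal_integer: "int_decimal z \<in> integer_decimals"
  by (simp add: integer_decimals_def int_decimal_digit)

lemma abs_value_int_decimal: "abs_value (int_decimal z) = \<bar>z\<bar>"
proof -
  obtain m where m: "\<bar>z\<bar> < 10 ^ m" using ex_power10_gt by blast
  obtain k where k: "\<forall>i\<ge>int k. digit (int_decimal z) i = 0" using ex_nat_digit_bound by blast
  \<comment> \<open>\<open>m\<close> makes reduction modulo the power of ten trivial, and
    \<open>k\<close> makes the sum contain every digit.\<close>
  let ?n = "max m k"
  have "(10::int) ^ m \<le> 10 ^ ?n" by (rule power_increasing) auto
  then have "\<bar>z\<bar> mod 10 ^ ?n = \<bar>z\<bar>" using m by (intro mod_pos_pos_trivial) linarith+
  moreover have "abs_value (int_decimal z) = (\<Sum>i<?n. digit (int_decimal z) (int i) * 10 ^ i)"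
    by (rule abs_value_eq_sum) (use k in auto)
  ultimately show ?thesis by (simp add: int_decimal_digit sum_div_mod_digits)
qed

lemma dec_sgn_int_decimal: "dec_sgn (int_decimal z) = sgn z"
proof (cases "z = 0")
  case False
  then have "int_decimal z \<noteq> Zero"
    using abs_value_int_decimal[of z] by (auto simp: abs_value_def)
  then show ?thesis
    using False by (auto simp: int_decimal_def make_decimal_def split: if_splits)
qed (simp add: int_decimal_def make_decimal_def)

lemma decadic_int_decimal: "decadic (int_decimal z) = z"
  by (simp add: decadic_eq dec_sgn_int_decimal abs_value_int_decimal sgn_mult_abs)

text \<open>The digits are recovered from the absolute value by division. The sign is recovered
  because a signed integer decimal has positive absolute value.\<close>

lemma int_decimal_decadic:
  assumes "d \<in> integer_decimals"
  shows "int_decimal (decadic d) = d"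
proof (rule decimal_eqI)
  have abs: "\<bar>decadic d\<bar> = abs_value d"
  proof (cases d)
    case (Signed s a)
    then show ?thesis using abs_value_nonneg by (cases s) (auto simp: decadic_eq)
  qed (simp add: abs_value_def)
  show "dec_sgn (int_decimal (decadic d)) = dec_sgn d"
  proof (cases d)
    case (Signed s a)
    then show ?thesis
      using abs_value_pos[of s a] assms by (cases s) (auto simp: dec_sgn_int_decimal)
  qed (simp add: dec_sgn_int_decimal)
  show "digit (int_decimal (decadic d)) i = digit d i" for i
    using assms digit_eq_abs_value_div_mod[of d "nat i"]
    by (auto simp: int_decimal_digit abs integer_decimals_def)
qed

lemma decimal_of_int_eq: "decimal_of_int z = int_decimal z"
  unfolding decimal_of_int_def
proof (rule the_inv_into_f_eq)
  show "inj_on decadic integer_decimals"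
    using int_decimal_decadic by (rule inj_on_inverseI)
qed (auto simp: decadic_int_decimal int_decimal_integer)

section \<open>Terminating decimals as real numbers\<close>

definition terminating :: "decimal set" where
  "terminating = {d. finite {i. digit d i \<noteq> 0}}"

text \<open>For infinitely many nonzero digits this sum is 0 by convention, so it is the intended
  value only on \<open>terminating\<close>. Nonterminating decimals enter through their
  truncations.\<close>

definition abs_real :: "decimal \<Rightarrow> real" where
  "abs_real d = (\<Sum>i | digit d i \<noteq> 0. of_int (digit d i) * 10 powi i)"

definition real_value :: "decimal \<Rightarrow> real" where
  "real_value d = of_int (dec_sgn d) * abs_real d"

lemma abs_real_eq_sum:
  assumes "finite S" and "\<And>i. i \<notin> S \<Longrightarrow> digit d i = 0"
  shows "abs_real d = (\<Sum>i\<in>S. of_int (digit d i) * 10 powi i)"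
  unfolding abs_real_def by (rule sum.mono_neutral_left) (use assms in auto)

lemma abs_real_nonneg: "0 \<le> abs_real d"
  unfolding abs_real_def by (intro sum_nonneg) (auto simp: digit_nonneg)

lemma abs_real_value: "\<bar>real_value d\<bar> = abs_real d"
proof (cases d)
  case (Signed s a)
  then show ?thesis using abs_real_nonneg by (cases s) (auto simp: real_value_def)
qed (simp add: real_value_def abs_real_def)

lemma real_value_shift: "real_value (shift k d) = 10 powi k * real_value d"
proof -
  have "abs_real (shift k d) = (\<Sum>i | digit d i \<noteq> 0. of_int (digit d i) * 10 powi (i + k))"
    unfolding abs_real_def
    by (rule sum.reindex_bij_witness[of _ "\<lambda>i. i + k" "\<lambda>i. i - k"]) (auto simp: digit_shift)
  also have "\<dots> = 10 powi k * abs_real d"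
    unfolding abs_real_def sum_distrib_left by (intro sum.cong) (auto simp: power_int_add)
  finally show ?thesis by (simp add: real_value_def dec_sgn_shift)
qed

lemma real_value_neg: "real_value (neg d) = - real_value d"
  by (simp add: real_value_def dec_sgn_neg abs_real_def digit_neg)

lemma real_value_two: "real_value two = 2"
  using abs_real_eq_sum[of "{0}" two] by (simp add: real_value_def dec_sgn_two digit_two)

lemma real_value_integer:
  assumes "d \<in> integer_decimals"
  shows "real_value d = of_int (decadic d)"
proof -
  have "{i. 0 \<le> i \<and> digit d i \<noteq> 0} = {i. digit d i \<noteq> 0}"
    using assms by (force simp: integer_decimals_def)
  then have "of_int (abs_value d) = (\<Sum>i | digit d i \<noteq> 0. real_of_int (digit d i * 10 ^ nat i))"
    by (simp add: abs_value_def)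
  also have "\<dots> = abs_real d"
    unfolding abs_real_def
  proof (rule sum.cong)
    fix i assume "i \<in> {i. digit d i \<noteq> 0}"
    then have "0 \<le> i" using assms by (force simp: integer_decimals_def)
    then show "real_of_int (digit d i * 10 ^ nat i) = of_int (digit d i) * 10 powi i"
      by (simp add: power_int_def)
  qed simp
  finally show ?thesis by (simp add: real_value_def decadic_eq)
qed

lemma integer_decimals_terminating:
  assumes "d \<in> integer_decimals"
  shows "d \<in> terminating"
proof -
  obtain k where "\<forall>i>k. digit d i = 0" using digit_eventually_zero by blast
  then have "{i. digit d i \<noteq> 0} \<subseteq> {0..k}"
    using assms by (force simp: integer_decimals_def)
  then show ?thesis by (auto simp: terminating_def intro: finite_subset)
qed

lemma terminating_shift:
  assumes "d \<in> terminating"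
  shows "shift k d \<in> terminating"
proof -
  have "{i. digit (shift k d) i \<noteq> 0} \<subseteq> (\<lambda>i. i + k) ` {i. digit d i \<noteq> 0}"
    by (auto simp: digit_shift intro!: image_eqI[of _ _ "_ - k"])
  then show ?thesis using assms by (auto simp: terminating_def intro: finite_subset)
qed

lemma terminating_truncate: "truncate d n \<in> terminating"
proof -
  obtain k where "\<forall>i>k. digit d i = 0" using digit_eventually_zero by blast
  then have "{i. digit (truncate d n) i \<noteq> 0} \<subseteq> {- int n..k}"
    by (auto simp: digit_truncate not_less[symmetric] split: if_splits)
  then show ?thesis by (auto simp: terminating_def intro: finite_subset)
qed

lemma terminating_neg: "d \<in> terminating \<Longrightarrow> neg d \<in> terminating"
  by (simp add: terminating_def digit_neg)

lemma terminating_lower_bound: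
  assumes "d \<in> terminating"
  shows "\<exists>n. \<forall>i < - int n. digit d i = 0"
proof -
  have fin: "finite {i. digit d i \<noteq> 0}" using assms by (simp add: terminating_def)
  \<comment> \<open>Inserting 0 keeps the set nonempty for the zero decimal and makes the minimum at
    most 0, so \<open>nat\<close> loses nothing.\<close>
  define n where "n = nat (- Min (insert 0 {i. digit d i \<noteq> 0}))"
  have "digit d i = 0" if "i < - int n" for i
  proof (rule ccontr)
    assume "digit d i \<noteq> 0"
    then have "Min (insert 0 {i. digit d i \<noteq> 0}) \<le> i" using fin by (intro Min_le) auto
    then show False using that unfolding n_def by linarith
  qed
  then show ?thesis by blast
qed

text \<open>\<open>common_shift\<close> is a \<open>SOME\<close> choice, so a witness is required:
  shifting by the sum of the two fractional lengths makes both decimals integral.\<close>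

lemma common_shift_integer:
  assumes "c \<in> terminating" "d \<in> terminating"
  shows "shift (common_shift c d) c \<in> integer_decimals \<and> shift (common_shift c d) d \<in> integer_decimals"
proof -
  obtain m n where "\<forall>i < - int m. digit c i = 0" "\<forall>i < - int n. digit d i = 0"
    using terminating_lower_bound assms by meson
  then have "shift (int (m + n)) c \<in> integer_decimals \<and> shift (int (m + n)) d \<in> integer_decimals"
    by (auto simp: integer_decimals_def digit_shift)
  then show ?thesis unfolding common_shift_def by (rule someI)
qed

lemma real_value_decimal_of_int: "real_value (decimal_of_int z) = of_int z"
  by (simp add: decimal_of_int_eq real_value_integer int_decimal_integer decadic_int_decimal)

lemma terminating_decimal_of_int: "decimal_of_int z \<in> terminating"
  by (simp add: decimal_of_int_eq int_decimal_integer integer_decimals_terminating)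

lemma terminating_t_add: "t_add c d \<in> terminating"
  by (simp add: t_add_def Let_def terminating_shift terminating_decimal_of_int)

lemma terminating_t_mult: "t_mult c d \<in> terminating"
  by (simp add: t_mult_def Let_def terminating_shift terminating_decimal_of_int)

text \<open>A shift by \<open>k\<close> scales the value by the \<open>k\<close>-th power of ten,
  and on integer decimals the operation is that of the integers; the scalings cancel.\<close>

lemma real_value_t_add:
  assumes "c \<in> terminating" "d \<in> terminating"
  shows "real_value (t_add c d) = real_value c + real_value d"
proof -
  let ?k = "common_shift c d"
  have "real_value (t_add c d) = 10 powi (- ?k) * (real_value (shift ?k c) + real_value (shift ?k d))"
    using common_shift_integer[OF assms]
    by (simp add: t_add_def Let_def real_value_shift[of "- ?k"] real_value_decimal_of_int
        real_value_integer)
  also have "\<dots> = real_value c + real_value d"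
    by (simp add: real_value_shift power_int_minus field_simps)
  finally show ?thesis .
qed

lemma real_value_t_mult:
  assumes "c \<in> terminating" "d \<in> terminating"
  shows "real_value (t_mult c d) = real_value c * real_value d"
proof -
  let ?k = "common_shift c d"
  have "real_value (t_mult c d) = 10 powi (- 2 * ?k) * (real_value (shift ?k c) * real_value (shift ?k d))"
    using common_shift_integer[OF assms]
    by (simp add: t_mult_def Let_def real_value_shift[of "- (2 * ?k)"] real_value_decimal_of_int
        real_value_integer)
  also have "10 powi (- 2 * ?k) = inverse ((10::real) powi ?k) * inverse (10 powi ?k)"
  proof -
    have eq: "- 2 * ?k = - ?k + - ?k" by simp
    show ?thesis unfolding eq by (subst power_int_add) (simp_all add: power_int_minus)
  qed
  also have "\<dots> * (real_value (shift ?k c) * real_value (shift ?k d)) = real_value c * real_value d"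
    by (simp add: real_value_shift field_simps)
  finally show ?thesis .
qed

lemma real_value_t_diff:
  assumes "c \<in> terminating" "d \<in> terminating"
  shows "real_value (t_diff c d) = real_value c - real_value d"
  using assms by (simp add: t_diff_def real_value_t_add terminating_neg real_value_neg)

section \<open>Hybrid limits and limits of real numbers\<close>

text \<open>The bound is the value of a block consisting only of nines.\<close>

lemma digit_block_bound:
  "(\<Sum>i\<in>{k - int n..<k}. real_of_int (digit d i) * 10 powi i) \<le> 10 powi k - 10 powi (k - int n)"
proof (induction n)
  case (Suc n)
  let ?j = "k - int n - 1"
  have "{k - int (Suc n)..<k} = insert ?j {k - int n..<k}" by auto
  then have "(\<Sum>i\<in>{k - int (Suc n)..<k}. real_of_int (digit d i) * 10 powi i)
      = of_int (digit d ?j) * 10 powi ?j + (\<Sum>i\<in>{k - int n..<k}. real_of_int (digit d i) * 10 powi i)"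
    by simp
  also have "\<dots> \<le> 9 * 10 powi ?j + (10 powi k - 10 powi (k - int n))"
    using digit_le_9[of d ?j] Suc by (intro add_mono mult_right_mono) auto
  also have "10 powi (k - int n) = (10::real) * 10 powi ?j"
    by (simp add: power_int_diff)
  finally show ?case by (simp add: algebra_simps)
qed simp

text \<open>A vanishing truncation confines the nonzero digits to a finite block strictly below
  position \<open>- int k\<close>.\<close>

lemma abs_real_le:
  assumes "d \<in> terminating" and "truncate d k = Zero"
  shows "abs_real d \<le> 10 powi (- int k)"
proof -
  obtain n where n: "\<forall>i < - int n. digit d i = 0" using terminating_lower_bound assms(1) by blast
  have z: "digit d i = 0" if "i \<ge> - int k" for i
    using digit_truncate[of d k i] assms(2) that by simp
  have "abs_real d = (\<Sum>i\<in>{- int k - int n..<- int k}. of_int (digit d i) * 10 powi i)"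
    by (rule abs_real_eq_sum) (use n z in auto)
  also have "\<dots> \<le> 10 powi (- int k) - 10 powi (- int k - int n)" by (rule digit_block_bound)
  also have "\<dots> \<le> 10 powi (- int k)" by simp
  finally show ?thesis .
qed

text \<open>The bridge from the digitwise notion of convergence to the library's: vanishing digits
  down to a given precision bound the absolute value by a power of 1/10.\<close>

lemma tends_to_zero_LIMSEQ:
  assumes "tends_to_zero c" and "\<And>n. c n \<in> terminating"
  shows "(\<lambda>n. real_value (c n)) \<longlonglongrightarrow> 0"
proof (rule LIMSEQ_I)
  fix r :: real assume "0 < r"
  then obtain k where k: "(1/10) ^ k < r" using real_arch_pow_inv[of r "1/10"] by auto
  \<comment> \<open>\<open>tends_to_zero\<close> speaks only of precisions at least 1, while
    \<open>k\<close> may be 0; hence \<open>Suc k\<close>.\<close>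
  obtain N where N: "\<forall>n>N. truncate (c n) (Suc k) = Zero"
    using assms(1) unfolding tends_to_zero_def by (metis Suc_leI zero_less_Suc One_nat_def)
  have "norm (real_value (c n) - 0) < r" if "n \<ge> Suc N" for n
  proof -
    have "norm (real_value (c n) - 0) \<le> 10 powi (- int (Suc k))"
      using abs_real_le[of "c n" "Suc k"] assms(2) N that by (simp add: abs_real_value)
    also have "\<dots> = (1/10) ^ Suc k"
      by (simp only: power_int_minus power_int_of_nat power_one_over inverse_eq_divide)
    also have "\<dots> \<le> (1/10) ^ k" by (rule power_decreasing) auto
    finally show ?thesis using k by simp
  qed
  then show "\<exists>N. \<forall>n\<ge>N. norm (real_value (c n) - 0) < r" by blast
qed

section \<open>Truncations of periodic decimals and the irrationality of the square root of
  two\<close>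

lemma abs_real_truncate_Suc:
  "abs_real (truncate d (Suc n))
    = abs_real (truncate d n) + of_int (digit d (- int (Suc n))) * 10 powi (- int (Suc n))"
proof -
  obtain k where k: "\<forall>i\<ge>int k. digit d i = 0" using ex_nat_digit_bound by blast
  have sum: "abs_real (truncate d n) = (\<Sum>i\<in>{- int n..int k}. of_int (digit d i) * 10 powi i)" for n
    by (subst abs_real_eq_sum[of "{- int n..int k}"]) (use k in \<open>auto simp: digit_truncate\<close>)
  have "{- int (Suc n)..int k} = insert (- int (Suc n)) {- int n..int k}" by auto
  then show ?thesis by (simp add: sum del: of_nat_Suc)
qed

lemma abs_real_Rats: "abs_real d \<in> \<rat>"
proof -
  have "(10::real) powi i \<in> \<rat>" for i by (simp add: power_int_def)
  then show ?thesis unfolding abs_real_def by (intro Rats_sum Rats_mult) auto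
qed

text \<open>The classical parity argument: in lowest terms, numerator and denominator would both be
  even.\<close>

lemma sqrt_2_not_Rats: "sqrt 2 \<notin> \<rat>"
proof
  assume "sqrt 2 \<in> \<rat>"
  then obtain m n :: nat where n: "n \<noteq> 0" and eq: "\<bar>sqrt 2\<bar> = real m / real n" and co: "coprime m n"
    by (rule Rats_abs_nat_div_natE)
  have "sqrt 2 * real n = real m" using eq n by (simp add: field_simps)
  then have "(real m)\<^sup>2 = (sqrt 2 * real n)\<^sup>2" by (rule arg_cong[OF sym])
  then have "real (m\<^sup>2) = real (2 * n\<^sup>2)" by (simp add: power_mult_distrib)
  then have mn: "m\<^sup>2 = 2 * n\<^sup>2" by (simp only: of_nat_eq_iff)
  then have "even m" by (metis dvd_triv_left even_power zero_less_numeral)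
  then obtain l where "m = 2 * l" by blast
  then have "n\<^sup>2 = 2 * l\<^sup>2" using mn by (simp add: power2_eq_square)
  then have "even n" by (metis dvd_triv_left even_power zero_less_numeral)
  with \<open>even m\<close> co show False by auto
qed

lemma periodic_truncations_limit_Rats:
  assumes "d \<in> ultimately_periodic" and lim: "(\<lambda>n. abs_real (truncate d n)) \<longlonglongrightarrow> l"
  shows "l \<in> \<rat>"
proof -
  obtain m p where p: "p \<ge> 1" and per: "\<forall>i<m. digit d i = digit d (i - int p)"
    using assms(1) by (auto simp: ultimately_periodic_def)
  let ?s = "\<lambda>n. abs_real (truncate d n)"
  define u where "u = (\<lambda>n. 10 ^ p * ?s (n + p) - ?s n)"
  \<comment> \<open>For \<open>n \<ge> N\<close> the next digit sits at position
    \<open>- int (Suc n)\<close>, which is below \<open>m\<close>, so periodicity applies to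
    it.\<close>
  define N where "N = nat (- m)"
  have step: "u (Suc n) = u n" if "n \<ge> N" for n
  proof -
    let ?i = "- int (Suc n)"
    have "?i < m" using that unfolding N_def by linarith
    then have dig: "digit d (?i - int p) = digit d ?i" using per by metis
    have pow: "10 ^ p * (10::real) powi (?i - int p) = 10 powi ?i"
      by (simp add: power_int_diff del: of_nat_Suc)
    have "- int (Suc (n + p)) = ?i - int p" by simp
    then have "abs_real (truncate d (Suc (n + p)))
        = ?s (n + p) + of_int (digit d ?i) * 10 powi (?i - int p)"
      by (simp only: abs_real_truncate_Suc dig)
    \<comment> \<open>The two truncations gain equal digits \<open>p\<close> places apart. The
      factor \<open>10 ^ p\<close> aligns these contributions, and they cancel.\<close>
    then have "u (Suc n) = 10 ^ p * ?s (n + p)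
        + of_int (digit d ?i) * (10 ^ p * 10 powi (?i - int p))
        - (?s n + of_int (digit d ?i) * 10 powi ?i)"
      by (simp add: u_def abs_real_truncate_Suc[of d n] algebra_simps del: of_nat_Suc)
    then show ?thesis unfolding pow by (simp add: u_def)
  qed
  have const: "u n = u N" if "n \<ge> N" for n
    using that by (induction n rule: dec_induct) (auto simp: step)
  have "u \<longlonglongrightarrow> u N"
    using const by (intro tendsto_eventually eventually_sequentiallyI)
  moreover have "u \<longlonglongrightarrow> 10 ^ p * l - l"
    unfolding u_def by (intro tendsto_intros lim LIMSEQ_ignore_initial_segment)
  ultimately have "10 ^ p * l - l = u N" using LIMSEQ_unique by blast
  then have "(10 ^ p - 1) * l = u N" by (simp add: algebra_simps)
  \<comment> \<open>Since \<open>p\<close> is positive, the factor \<open>10 ^ p - 1\<close> is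
    nonzero and the equation can be solved for \<open>l\<close>.\<close>
  moreover have "(1::real) < 10 ^ p" using p by (intro one_less_power) auto
  ultimately have "l = u N / (10 ^ p - 1)" by (simp add: field_simps)
  moreover have "u N \<in> \<rat>" unfolding u_def by (intro Rats_diff Rats_mult abs_real_Rats) auto
  ultimately show ?thesis by (auto intro!: Rats_divide Rats_diff)
qed

theorem proposition3p1:
  "\<not> (\<exists>x \<in> classes_meeting ultimately_periodic. r_square x = class_of two)"
proof
  assume "\<exists>x \<in> classes_meeting ultimately_periodic. r_square x = class_of two"
  then obtain x where x: "x \<in> dec_reals" "x \<inter> ultimately_periodic \<noteq> {}"
    and sq: "r_square x = class_of two"
    by (auto simp: classes_meeting_def)
  \<comment> \<open>This is the very choice made inside \<open>r_mult\<close>, for both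
    factors.\<close>
  define c where "c = (SOME c. c \<in> x)"
  obtain q where q: "q \<in> x" "q \<in> ultimately_periodic" using x(2) by blast
  have "c \<in> x" unfolding c_def using q(1) by (rule someI)
  \<comment> \<open>Both \<open>q\<close> and \<open>c\<close> are related directly to the
    representative \<open>y\<close>, so periodicity passes from \<open>q\<close> to \<open>y\<close>
    and on to \<open>c\<close>.\<close>
  obtain y where y: "x = sim `` {y}" using x(1) by (auto simp: dec_reals_def elim: quotientE)
  have "y \<in> ultimately_periodic" using q y sim_ultimately_periodic[of y q] by auto
  then have per: "c \<in> ultimately_periodic"
    using \<open>c \<in> x\<close> y sim_ultimately_periodic[of y c] by auto
  have "two \<in> class_of two" by (simp add: class_of_def sim_def)
  then have "two \<in> hlim (\<lambda>n. t_mult (truncate c n) (truncate c n))"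
    using sq by (simp add: r_square_def r_mult_def c_def Let_def)
  then have "tends_to_zero (\<lambda>n. t_diff (t_mult (truncate c n) (truncate c n)) two)"
    by (simp add: hlim_def truncate_two)
  then have "(\<lambda>n. real_value (t_diff (t_mult (truncate c n) (truncate c n)) two)) \<longlonglongrightarrow> 0"
    by (rule tends_to_zero_LIMSEQ) (simp add: t_diff_def terminating_t_add)
  moreover have "two \<in> terminating" using terminating_truncate[of two] by (simp add: truncate_two)
  ultimately have "(\<lambda>n. real_value (truncate c n) * real_value (truncate c n) - 2) \<longlonglongrightarrow> 0"
    by (simp add: real_value_t_diff real_value_t_mult terminating_t_mult terminating_truncate
        real_value_two)
  then have "(\<lambda>n. real_value (truncate c n) * real_value (truncate c n)) \<longlonglongrightarrow> 2"
    by (simp add: LIM_zero_iff)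
  \<comment> \<open>The root of the square is the absolute value, so the sign of \<open>c\<close>
    drops out.\<close>
  then have "(\<lambda>n. sqrt (real_value (truncate c n) * real_value (truncate c n))) \<longlonglongrightarrow> sqrt 2"
    by (rule tendsto_real_sqrt)
  then have "(\<lambda>n. abs_real (truncate c n)) \<longlonglongrightarrow> sqrt 2"
    by (simp add: abs_real_value)
  then show False using periodic_truncations_limit_Rats[OF per] sqrt_2_not_Rats by blast
qed

end
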